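(* Let $k_1\neq k_2$ be integers with $k_1,k_2\ge 2$. Then the product polytope $\mathcal{P}_{k_1,k_1+2}\times\mathcal{P}_{k_2,k_2+2}$ is very ample, and its gap vector has exactly two nonzero entries, at positions $k_1$ and $k_2$.
   Context: Let $k\ge2$ and $a\ge0$ be integers. Let $C_{2k}$ be the cycle with vertices $1,\dots,2k$ in cyclic order and edges $(i,i+1)$, $i=1,\dots,2k$, where $(2k,2k+1)$ means $(2k,1)$. For an edge $e$ let $V(e)\in\mathbb{Z}^{2k}$ be the vector with coordinates $V(e)_v=1$ if $v\in e$ and $V(e)_v=0$ otherwise. The polytope $\mathcal{P}_{k,a}$ is the convex hull in $\mathbb{Z}^{2k}\times\mathbb{Z}$ (tensored with the reals) of the points $(V(i,i+1),0)$, $(V(i,i+1),1)$ for $i=2,3,\dots,2k$, together with $(V(1,2),a)$ and $(V(1,2),a+1)$. Products of polytopes are considered in the product of the lattices. A lattice polytope $\mathcal{P}$ is very ample in a lattice $M$ if for every sufficiently large integer $m$ every lattice point in $m\mathcal{P}$ is a sum of $m$ lattice points of $\mathcal{P}$. For a lattice polytope $\mathcal{P}$ in a lattice $M$, $Ehr_{\mathcal{P}}(j)$ is the number of lattice points in $j\mathcal{P}$, and $H_{\mathcal{P}}(j)$ is the number of points with first coordinate $j$ in the semigroup generated by the lattice points of $\{1\}\times\mathcal{P}\subset \mathbb{R}\times M_{\mathbb{R}}$. The gap vector is $\gamma(\mathcal{P})_j:=Ehr_{\mathcal{P}}(j)-H_{\mathcal{P}}(j)$, $j\ge 1$. *)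

theory Defs
  imports "HOL-Analysis.Analysis" "HOL-Analysis.Finite_Function_Topology"
begin

text \<open>
  A lattice is given by its set of points \<open>M\<close> inside an ambient real vector space, and a
  polytope by its set of points in that space.
\<close>

definition lattice_polytope :: "'a::real_vector set \<Rightarrow> 'a set \<Rightarrow> bool" where
  "lattice_polytope M P \<longleftrightarrow> (\<exists>V. finite V \<and> V \<subseteq> M \<and> P = convex hull V)"

definition dilate :: "nat \<Rightarrow> 'a::real_vector set \<Rightarrow> 'a set" where
  "dilate m P = (\<lambda>x. real m *\<^sub>R x) ` P"

definition very_ample :: "'a::real_vector set \<Rightarrow> 'a set \<Rightarrow> bool" where
  "very_ample M P \<longleftrightarrow> lattice_polytope M P \<and>
     (\<exists>m0. \<forall>m\<ge>m0. \<forall>x \<in> dilate m P \<inter> M.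
        \<exists>p. (\<forall>i<m. p i \<in> P \<inter> M) \<and> x = (\<Sum>i<m. p i))"

definition Ehr :: "'a::real_vector set \<Rightarrow> 'a set \<Rightarrow> nat \<Rightarrow> nat" where
  "Ehr M P j = card (dilate j P \<inter> M)"

inductive_set semigroup_gen :: "'a::semigroup_add set \<Rightarrow> 'a set" for G where
  gen: "x \<in> G \<Longrightarrow> x \<in> semigroup_gen G"
| add: "x \<in> semigroup_gen G \<Longrightarrow> y \<in> semigroup_gen G \<Longrightarrow> x + y \<in> semigroup_gen G"

definition Hilb :: "'a::real_vector set \<Rightarrow> 'a set \<Rightarrow> nat \<Rightarrow> nat" where
  "Hilb M P j =
     card {z \<in> semigroup_gen (({1::real} \<times> P) \<inter> (\<int> \<times> M)). fst z = real j}"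

text \<open>Only the entries with \<open>j \<ge> 1\<close> belong to the gap vector.\<close>

definition gap_vector :: "'a::real_vector set \<Rightarrow> 'a set \<Rightarrow> nat \<Rightarrow> int" where
  "gap_vector M P j = int (Ehr M P j) - int (Hilb M P j)"

text \<open>
  Since \<open>k\<close> varies, \<open>\<real>\<^sup>2\<^sup>k\<close> is realised as the subspace of the finitely supported functions
  \<open>nat \<Rightarrow>\<^sub>0 real\<close> with support in \<open>{1..2 * k}\<close>; the last coordinate is a separate factor \<open>real\<close>.
\<close>

definition cyc_lattice :: "nat \<Rightarrow> ((nat \<Rightarrow>\<^sub>0 real) \<times> real) set" where
  "cyc_lattice k =
     {x. Poly_Mapping.keys x \<subseteq> {1..2 * k} \<and> (\<forall>v. Poly_Mapping.lookup x v \<in> \<int>)} \<times> \<int>"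

definition cyc_edge :: "nat \<Rightarrow> nat \<Rightarrow> nat set" where
  "cyc_edge k i = {i, if i = 2 * k then 1 else i + 1}"

definition edge_vec :: "nat set \<Rightarrow> nat \<Rightarrow>\<^sub>0 real" where
  "edge_vec e = (\<Sum>v\<in>e. Poly_Mapping.single v 1)"

lemma lookup_edge_vec:
  "finite e \<Longrightarrow> Poly_Mapping.lookup (edge_vec e) v = (if v \<in> e then 1 else 0)"
  by (simp add: edge_vec_def lookup_sum lookup_single when_def)

definition cyc_polytope :: "nat \<Rightarrow> nat \<Rightarrow> ((nat \<Rightarrow>\<^sub>0 real) \<times> real) set" where
  "cyc_polytope k a = convex hull
     ((\<Union>i\<in>{2..2 * k}. {(edge_vec (cyc_edge k i), 0), (edge_vec (cyc_edge k i), 1)}) \<union>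
      {(edge_vec (cyc_edge k 1), real a), (edge_vec (cyc_edge k 1), real (a + 1))})"

end

theory Submission
  imports Defs
begin

text \<open>
  Write \<open>a = k + 2\<close>. A point \<open>(x, h)\<close> lies in \<open>m P\<close>, where \<open>P\<close> is the polytope of the cycle of
  length \<open>2 k\<close>, iff \<open>x\<close> is the vector of vertex sums of a nonnegative edge weighting \<open>w\<close> of total
  weight \<open>m\<close> and \<open>a w\<^sub>1 \<le> h \<le> a w\<^sub>1 + m\<close> (\<open>cyc_polytope_eq_real_level\<close>, \<open>dilate_cyc_polytope\<close>). The
  sums of \<open>m\<close> lattice points of \<open>P\<close> are given by the same condition with \<open>w\<close> and \<open>h\<close> integral
  (\<open>nfold_sums_vertices\<close>, \<open>lattice_points_cyc_polytope\<close>).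

  On an even cycle the weightings with given vertex sums form a line, whose direction is the
  alternating weighting. If all vertex sums are integers, then every weight on an odd edge has the
  same fractional part \<open>f\<close> as \<open>w\<^sub>1\<close>, and every weight on an even edge the fractional part of
  \<open>- f\<close>. So \<open>w\<close> can be moved along the line to an integral nonnegative weighting in two directions,
  making the first weight \<open>s = w\<^sub>1 - f\<close> or \<open>s + 1\<close>. The first is good for the
  heights up to \<open>a s + m\<close>, the second for those from \<open>a (s + 1)\<close> on, and together they cover all
  integral heights as soon as \<open>a \<le> m + 1\<close>, that is \<open>m > k\<close>. On the other hand, if \<open>f > 0\<close>, then the
  first integral weighting has a weight of at least \<open>1\<close> on all \<open>k\<close> even edges, hence \<open>m \<ge> k\<close>;
  so for \<open>m < k\<close> the weighting was integral to begin with. This leaves the dilation factor \<open>m = k\<close>,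
  at which the all-ones vector at height \<open>k + 1\<close> falls between the heights \<open>0, \<dots>, k\<close>
  and \<open>k + 2, \<dots>, 2 k + 2\<close> of the two integral weightings (\<open>gap_point\<close>).

  Both the set of lattice points of \<open>m P\<close> and the set of \<open>m\<close>-fold sums are compatible with products
  (\<open>dilate_Times\<close>, \<open>nfold_sums_Times\<close>). All these sets are nonempty and finite, so the product has a
  gap at \<open>m\<close> iff one of its factors has one. In particular there are only finitely many gaps, which
  is very ampleness.
\<close>

section \<open>Multiple sumsets and products\<close>

definition nfold_sums :: "'a::comm_monoid_add set \<Rightarrow> nat \<Rightarrow> 'a set" where
  "nfold_sums G m = {\<Sum>i<m. p i | p. \<forall>i<m. p i \<in> G}"

lemma nfold_sums_0 [simp]: "nfold_sums G 0 = {0}"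
  by (auto simp: nfold_sums_def)

lemma nfold_sums_Suc: "nfold_sums G (Suc m) = {x + g | x g. x \<in> nfold_sums G m \<and> g \<in> G}"
proof (intro equalityI subsetI)
  fix z assume "z \<in> nfold_sums G (Suc m)"
  then show "z \<in> {x + g | x g. x \<in> nfold_sums G m \<and> g \<in> G}"
    unfolding nfold_sums_def by fastforce
next
  fix z assume "z \<in> {x + g | x g. x \<in> nfold_sums G m \<and> g \<in> G}"
  then obtain p g where p: "\<forall>i<m. p i \<in> G" and g: "g \<in> G" and z: "z = (\<Sum>i<m. p i) + g"
    unfolding nfold_sums_def by blast
  have "\<forall>i<Suc m. (p(m := g)) i \<in> G"
    using p g by (simp add: less_Suc_eq)
  moreover have "z = (\<Sum>i<Suc m. (p(m := g)) i)"
    by (simp add: z)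
  ultimately show "z \<in> nfold_sums G (Suc m)"
    unfolding nfold_sums_def by blast
qed

lemma nfold_sums_1 [simp]: "nfold_sums G (Suc 0) = G"
  by (simp add: nfold_sums_Suc)

lemma nfold_sums_add:
  assumes "x \<in> nfold_sums G m" and "y \<in> nfold_sums G n"
  shows "x + y \<in> nfold_sums G (m + n)"
  using assms(2)
proof (induction n arbitrary: y)
  case 0
  then show ?case using assms(1) by simp
next
  case (Suc n)
  then obtain y' g where "y' \<in> nfold_sums G n" "g \<in> G" "y = y' + g"
    by (auto simp: nfold_sums_Suc)
  then show ?case
    using Suc.IH[of y'] by (auto simp: nfold_sums_Suc simp flip: add.assoc)
qed

lemma nfold_sums_Times: "nfold_sums (A \<times> B) m = nfold_sums A m \<times> nfold_sums B m"
proof (induction m)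
  case 0
  then show ?case by (auto simp: zero_prod_def)
next
  case (Suc m)
  show ?case
    unfolding nfold_sums_Suc Suc by (auto; blast)
qed

text \<open>
  The generators have first coordinate \<open>1\<close>, so that coordinate counts the summands, and the part
  of the semigroup at height \<open>m\<close> is the \<open>m\<close>-fold sumset.
\<close>

lemma semigroup_gen_height_one:
  "z \<in> semigroup_gen (({1::real} \<times> P) \<inter> (\<int> \<times> M)) \<longleftrightarrow>
     (\<exists>m\<ge>1. \<exists>x\<in>nfold_sums (P \<inter> M) m. z = (real m, x))"
  (is "z \<in> semigroup_gen ?G \<longleftrightarrow> _")
proof
  assume "z \<in> semigroup_gen ?G"
  then show "\<exists>m\<ge>1. \<exists>x\<in>nfold_sums (P \<inter> M) m. z = (real m, x)"
  proof induction
    case (gen z)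
    then show ?case by (intro exI[of _ 1]) auto
  next
    case (add y z)
    then obtain m n u v where "m \<ge> 1" "n \<ge> 1" "u \<in> nfold_sums (P \<inter> M) m"
      "v \<in> nfold_sums (P \<inter> M) n" "y = (real m, u)" "z = (real n, v)"
      by blast
    then show ?case
      by (intro exI[of _ "m + n"]) (auto intro!: nfold_sums_add bexI[of _ "u + v"])
  qed
next
  have "x \<in> nfold_sums (P \<inter> M) (Suc n) \<Longrightarrow> (real (Suc n), x) \<in> semigroup_gen ?G" for n x
  proof (induction n arbitrary: x)
    case 0
    then show ?case by (auto intro: semigroup_gen.gen)
  next
    case (Suc n)
    then obtain y g where y: "y \<in> nfold_sums (P \<inter> M) (Suc n)" and "g \<in> P \<inter> M"
      and x: "x = y + g"
      by (subst (asm) nfold_sums_Suc) auto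
    then have "(1, g) \<in> semigroup_gen ?G"
      by (auto intro: semigroup_gen.gen)
    from semigroup_gen.add[OF Suc.IH[OF y] this] show ?case
      by (simp add: x algebra_simps)
  qed
  moreover assume "\<exists>m\<ge>1. \<exists>x\<in>nfold_sums (P \<inter> M) m. z = (real m, x)"
  ultimately show "z \<in> semigroup_gen ?G"
    by (metis Suc_le_D One_nat_def)
qed

lemma Hilb_eq_card_nfold_sums:
  assumes "j \<ge> 1"
  shows "Hilb M P j = card (nfold_sums (P \<inter> M) j)"
proof -
  have "{z \<in> semigroup_gen (({1::real} \<times> P) \<inter> (\<int> \<times> M)). fst z = real j}
      = {real j} \<times> nfold_sums (P \<inter> M) j"
    using assms by (auto simp: semigroup_gen_height_one)
  then show ?thesis
    by (simp add: Hilb_def card_cartesian_product)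
qed

lemma dilate_Times: "dilate m (P \<times> Q) = dilate m P \<times> dilate m Q"
  unfolding dilate_def by (auto simp: image_iff)

lemma lattice_polytope_Times:
  assumes "lattice_polytope M P" and "lattice_polytope N Q"
  shows "lattice_polytope (M \<times> N) (P \<times> Q)"
proof -
  obtain V W where "finite V" "V \<subseteq> M" "P = convex hull V" "finite W" "W \<subseteq> N" "Q = convex hull W"
    using assms unfolding lattice_polytope_def by blast
  then show ?thesis
    unfolding lattice_polytope_def
    by (intro exI[of _ "V \<times> W"]) (auto simp: convex_hull_Times)
qed

lemma very_ample_iff_nfold_sums:
  "very_ample M P \<longleftrightarrow>
     lattice_polytope M P \<and> (\<exists>m0. \<forall>m\<ge>m0. dilate m P \<inter> M \<subseteq> nfold_sums (P \<inter> M) m)"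
  unfolding very_ample_def nfold_sums_def subset_iff by (simp add: Ball_def) metis

lemma Times_eq_iff_of_subset:
  assumes "A \<subseteq> A'" and "B \<subseteq> B'" and "A \<noteq> {}" and "B \<noteq> {}"
  shows "A \<times> B = A' \<times> B' \<longleftrightarrow> A = A' \<and> B = B'"
  using assms by (simp add: times_eq_iff)

text \<open>
  Finiteness matters: an infinite set of lattice points would have cardinality \<open>0\<close>.
\<close>

lemma gap_vector_nonzero_iff:
  assumes "j \<ge> 1" and "finite (dilate j P \<inter> M)" and "nfold_sums (P \<inter> M) j \<subseteq> dilate j P \<inter> M"
  shows "gap_vector M P j \<noteq> 0 \<longleftrightarrow> nfold_sums (P \<inter> M) j \<noteq> dilate j P \<inter> M"
  using card_subset_eq[OF assms(2,3)] assms(1)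
  by (auto simp: gap_vector_def Ehr_def Hilb_eq_card_nfold_sums)

section \<open>Edge weightings of an even cycle\<close>

text \<open>
  The vector of vertex sums of the edge weighting \<open>w\<close>.
\<close>

definition edge_comb :: "nat \<Rightarrow> (nat \<Rightarrow> real) \<Rightarrow> nat \<Rightarrow>\<^sub>0 real" where
  "edge_comb k w = (\<Sum>i=1..2*k. w i *\<^sub>R edge_vec (cyc_edge k i))"

lemma lookup_scaleR [simp]:
  "Poly_Mapping.lookup (r *\<^sub>R x) v = r *\<^sub>R Poly_Mapping.lookup x v"
proof -
  have "finite {i. r *\<^sub>R Poly_Mapping.lookup x i \<noteq> 0}"
    by (rule finite_subset[OF _ finite_lookup[of x]]) auto
  then show ?thesis
    by (simp add: scaleR_poly_mapping_def)
qed

lemma edge_comb_add: "edge_comb k (\<lambda>i. w i + u i) = edge_comb k w + edge_comb k u"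
  by (simp add: edge_comb_def scaleR_add_left sum.distrib)

lemma edge_comb_scale: "edge_comb k (\<lambda>i. c * w i) = c *\<^sub>R edge_comb k w"
  by (simp add: edge_comb_def scaleR_sum_right)

lemma edge_comb_cong:
  "(\<And>i. i \<in> {1..2*k} \<Longrightarrow> w i = u i) \<Longrightarrow> edge_comb k w = edge_comb k u"
  by (simp add: edge_comb_def)

lemma edge_comb_indicator:
  assumes "i \<in> {1..2*k}"
  shows "edge_comb k (\<lambda>j. if j = i then 1 else 0) = edge_vec (cyc_edge k i)"
  using assms by (simp add: edge_comb_def if_distrib[of "\<lambda>c. c *\<^sub>R _"] sum.delta cong: if_cong)

lemma lookup_edge_comb:
  assumes "k \<ge> 1"
  shows "Poly_Mapping.lookup (edge_comb k w) v =
    (if v \<in> {1..2*k} then w v + w (if v = 1 then 2*k else v - 1) else 0)"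
proof -
  have "Poly_Mapping.lookup (edge_comb k w) v =
      (\<Sum>i=1..2*k. if v \<in> cyc_edge k i then w i else 0)"
    unfolding edge_comb_def lookup_sum
    by (intro sum.cong) (auto simp: lookup_edge_vec cyc_edge_def)
  also have "\<dots> = sum w {i\<in>{1..2*k}. v \<in> cyc_edge k i}"
    by (simp add: sum.If_cases Int_def)
  also have "{i\<in>{1..2*k}. v \<in> cyc_edge k i} =
      (if v \<in> {1..2*k} then {v, if v = 1 then 2*k else v - 1} else {})"
    using assms by (auto simp: cyc_edge_def split: if_splits)
  finally show ?thesis
    using assms by auto
qed

lemma edge_comb_mem_lattice:
  assumes "k \<ge> 1" and "h \<in> \<int>"
  shows "(edge_comb k w, h) \<in> cyc_lattice k \<longleftrightarrow>
    w 1 + w (2*k) \<in> \<int> \<and> (\<forall>i\<in>{1..<2*k}. w i + w (Suc i) \<in> \<int>)"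
proof -
  have "Poly_Mapping.keys (edge_comb k w) \<subseteq> {1..2*k}"
    using assms by (auto simp: in_keys_iff lookup_edge_comb split: if_splits)
  then have "(edge_comb k w, h) \<in> cyc_lattice k \<longleftrightarrow>
      (\<forall>v\<in>{1..2*k}. w v + w (if v = 1 then 2*k else v - 1) \<in> \<int>)"
    using assms by (auto simp: cyc_lattice_def lookup_edge_comb)
  also have "\<dots> \<longleftrightarrow> w 1 + w (2*k) \<in> \<int> \<and> (\<forall>i\<in>{1..<2*k}. w i + w (Suc i) \<in> \<int>)"
  proof -
    have *: "{1..2*k} = insert 1 (Suc ` {1..<2*k})"
      using assms(1) by (auto simp: image_Suc_atLeastLessThan)
    show ?thesis
      unfolding * by (auto simp: add.commute simp del: image_Suc_atLeastLessThan)
  qed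
  finally show ?thesis .
qed

text \<open>
  The alternating weightings span the kernel of the map from edge weightings to vertex sums; this
  is where the even length of the cycle is used.
\<close>

definition alternate :: "real \<Rightarrow> nat \<Rightarrow> real" where
  "alternate d i = (if odd i then d else - d)"

lemma edge_comb_alternate:
  assumes "k \<ge> 1"
  shows "edge_comb k (alternate d) = 0"
  by (rule poly_mapping_eqI) (use assms in \<open>auto simp: lookup_edge_comb alternate_def\<close>)

lemma sum_alternate: "sum (alternate d) {Suc 0..2*k} = 0"
  by (induction k) (simp_all add: alternate_def)

section \<open>The dilates as sets of weightings with a height\<close>

text \<open>
  The two descriptions that are compared: \<open>real_level\<close> turns out to be the dilate by \<open>m\<close>, and
  \<open>int_level\<close> the set of sums of \<open>m\<close> lattice points of the polytope.
\<close>

definition real_level :: "nat \<Rightarrow> nat \<Rightarrow> real \<Rightarrow> ((nat \<Rightarrow>\<^sub>0 real) \<times> real) set" where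
  "real_level k a m = {(edge_comb k w, h) | w h.
     (\<forall>i\<in>{1..2*k}. 0 \<le> w i) \<and> sum w {1..2*k} = m \<and> a * w 1 \<le> h \<and> h \<le> a * w 1 + m}"

definition int_level :: "nat \<Rightarrow> nat \<Rightarrow> nat \<Rightarrow> ((nat \<Rightarrow>\<^sub>0 real) \<times> real) set" where
  "int_level k a m = {(edge_comb k (\<lambda>i. real (w i)), real h) | w h.
     sum w {1..2*k} = m \<and> a * w 1 \<le> h \<and> h \<le> a * w 1 + m}"

lemma real_levelI:
  assumes "\<And>i. i \<in> {1..2*k} \<Longrightarrow> 0 \<le> w i" and "sum w {1..2*k} = m"
    and "a * w 1 \<le> h" and "h \<le> a * w 1 + m"
  shows "(edge_comb k w, h) \<in> real_level k a m"
  using assms unfolding real_level_def by blast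

lemma real_levelE:
  assumes "z \<in> real_level k a m"
  obtains w and h :: real where "z = (edge_comb k w, h)" and "\<forall>i\<in>{1..2*k}. 0 \<le> w i"
    and "sum w {1..2*k} = m" and "a * w 1 \<le> h" and "h \<le> a * w 1 + m"
  using assms unfolding real_level_def by blast

lemma convex_real_level: "convex (real_level k a m)"
proof (rule convexI)
  fix x y and u v :: real
  assume x: "x \<in> real_level k a m" and y: "y \<in> real_level k a m"
    and uv: "0 \<le> u" "0 \<le> v" "u + v = 1"
  obtain w :: "nat \<Rightarrow> real" and h :: real where w: "x = (edge_comb k w, h)" "\<forall>i\<in>{1..2*k}. 0 \<le> w i" "sum w {1..2*k} = m"
    "a * w 1 \<le> h" "h \<le> a * w 1 + m"
    using x by (rule real_levelE)
  obtain w' :: "nat \<Rightarrow> real" and h' :: real where w': "y = (edge_comb k w', h')" "\<forall>i\<in>{1..2*k}. 0 \<le> w' i"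
    "sum w' {1..2*k} = m" "a * w' 1 \<le> h'" "h' \<le> a * w' 1 + m"
    using y by (rule real_levelE)
  have m: "u * m + v * m = m"
    using uv by (simp flip: distrib_right)
  have "u *\<^sub>R x + v *\<^sub>R y = (edge_comb k (\<lambda>i. u * w i + v * w' i), u * h + v * h')"
    by (simp add: w(1) w'(1) edge_comb_add edge_comb_scale)
  also have "\<dots> \<in> real_level k a m"
  proof (rule real_levelI)
    show "(\<Sum>i=1..2*k. u * w i + v * w' i) = m"
      using w(3) w'(3) m by (simp add: sum.distrib flip: sum_distrib_left)
    show "a * (u * w 1 + v * w' 1) \<le> u * h + v * h'"
      using mult_left_mono[OF w(4) uv(1)] mult_left_mono[OF w'(4) uv(2)]
      by (simp add: algebra_simps)
    show "u * h + v * h' \<le> a * (u * w 1 + v * w' 1) + m"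
      using mult_left_mono[OF w(5) uv(1)] mult_left_mono[OF w'(5) uv(2)] m
      by (simp add: algebra_simps)
  qed (use uv w w' in auto)
  finally show "u *\<^sub>R x + v *\<^sub>R y \<in> real_level k a m" .
qed

definition base_height :: "nat \<Rightarrow> nat \<Rightarrow> nat" where
  "base_height a i = (if i = 1 then a else 0)"

lemma sum_base_height:
  fixes w :: "nat \<Rightarrow> real"
  assumes "k \<ge> 1"
  shows "(\<Sum>i=1..2*k. w i * base_height a i) = a * w 1"
proof -
  have "(\<Sum>i=1..2*k. w i * base_height a i) = (\<Sum>i=1..2*k. if i = 1 then a * w 1 else 0)"
    by (intro sum.cong) (auto simp: base_height_def)
  then show ?thesis
    using assms by simp
qed

definition cyc_vertices :: "nat \<Rightarrow> nat \<Rightarrow> ((nat \<Rightarrow>\<^sub>0 real) \<times> real) set" where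
  "cyc_vertices k a = (\<Union>i\<in>{1..2*k}. \<Union>d\<in>{0,1}.
     {(edge_vec (cyc_edge k i), real (base_height a i + d))})"

lemma cyc_polytope_eq_hull:
  assumes "k \<ge> 1"
  shows "cyc_polytope k a = convex hull cyc_vertices k a"
proof -
  have "{1..2*k} = insert 1 {2..2*k}"
    using assms by auto
  then have "cyc_vertices k a =
     (\<Union>i\<in>{2..2 * k}. {(edge_vec (cyc_edge k i), 0), (edge_vec (cyc_edge k i), 1)}) \<union>
      {(edge_vec (cyc_edge k 1), real a), (edge_vec (cyc_edge k 1), real (a + 1))}"
    by (auto simp: cyc_vertices_def base_height_def)
  then show ?thesis
    by (simp add: cyc_polytope_def)
qed

lemma edge_in_real_level:
  fixes h :: real
  assumes "k \<ge> 1" and "i \<in> {1..2*k}" and "base_height a i \<le> h" and "h \<le> base_height a i + 1"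
  shows "(edge_vec (cyc_edge k i), h) \<in> real_level k a 1"
  unfolding edge_comb_indicator[OF assms(2), symmetric]
  using assms by (intro real_levelI) (auto simp: base_height_def)

text \<open>
  A point of the right-hand side exceeds the lower bound \<open>a w\<^sub>1\<close> by some \<open>t \<in> [0, 1]\<close>. Over every
  edge take the point at relative height \<open>t\<close> of the vertical segment between the two vertices there;
  the given point is the convex combination of these with coefficients \<open>w\<^sub>i\<close>.
\<close>

lemma cyc_polytope_eq_real_level:
  assumes "k \<ge> 1"
  shows "cyc_polytope k a = real_level k a 1"
proof
  have "cyc_vertices k a \<subseteq> real_level k a 1"
    unfolding cyc_vertices_def using edge_in_real_level[OF assms] by auto
  then show "cyc_polytope k a \<subseteq> real_level k a 1"
    unfolding cyc_polytope_eq_hull[OF assms] by (intro hull_minimal convex_real_level)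
next
  show "real_level k a 1 \<subseteq> cyc_polytope k a"
  proof
    fix z assume "z \<in> real_level k a 1"
    then obtain w :: "nat \<Rightarrow> real" and h :: real where z: "z = (edge_comb k w, h)" and w: "\<forall>i\<in>{1..2*k}. 0 \<le> w i"
      "sum w {1..2*k} = 1" and h: "a * w 1 \<le> h" "h \<le> a * w 1 + 1"
      by (rule real_levelE)
    define t where "t = h - a * w 1"
    define y where "y i = (edge_vec (cyc_edge k i), base_height a i + t)" for i
    have "y i \<in> convex hull cyc_vertices k a" if "i \<in> {1..2*k}" for i
    proof -
      have "(edge_vec (cyc_edge k i), real (base_height a i + d)) \<in> convex hull cyc_vertices k a"
        if "d \<in> {0,1}" for d
        using \<open>i \<in> {1..2*k}\<close> that by (intro hull_inc) (auto simp: cyc_vertices_def)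
      from this[of 0] this[of 1]
      have "(1 - t) *\<^sub>R (edge_vec (cyc_edge k i), real (base_height a i + 0)) +
          t *\<^sub>R (edge_vec (cyc_edge k i), real (base_height a i + 1)) \<in> convex hull cyc_vertices k a"
        using h by (intro convexD[OF convex_convex_hull]) (auto simp del: of_nat_add simp: t_def)
      moreover have "(1 - t) *\<^sub>R edge_vec (cyc_edge k i) + t *\<^sub>R edge_vec (cyc_edge k i) =
          edge_vec (cyc_edge k i)"
        by (simp flip: scaleR_add_left)
      ultimately show ?thesis
        by (simp add: y_def distrib_left left_diff_distrib)
    qed
    then have "(\<Sum>i=1..2*k. w i *\<^sub>R y i) \<in> convex hull cyc_vertices k a"
      using w by (intro convex_sum) auto
    also have "(\<Sum>i=1..2*k. w i *\<^sub>R y i) = z"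
    proof (rule prod_eqI)
      show "fst (\<Sum>i=1..2*k. w i *\<^sub>R y i) = fst z"
        by (simp add: fst_sum y_def z edge_comb_def)
      show "snd (\<Sum>i=1..2*k. w i *\<^sub>R y i) = snd z"
        using w(2) sum_base_height[OF assms, of w a]
        by (simp add: snd_sum y_def z t_def distrib_left sum.distrib flip: sum_distrib_right)
    qed
    finally show "z \<in> cyc_polytope k a"
      by (simp add: cyc_polytope_eq_hull[OF assms])
  qed
qed

lemma real_level_scale:
  assumes "z \<in> real_level k a m" and "c \<ge> 0"
  shows "c *\<^sub>R z \<in> real_level k a (c * m)"
proof -
  obtain w :: "nat \<Rightarrow> real" and h :: real where z: "z = (edge_comb k w, h)" and w: "\<forall>i\<in>{1..2*k}. 0 \<le> w i"
    "sum w {1..2*k} = m" and h: "a * w 1 \<le> h" "h \<le> a * w 1 + m"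
    using assms(1) by (rule real_levelE)
  have "(edge_comb k (\<lambda>i. c * w i), c * h) \<in> real_level k a (c * m)"
    using w assms(2) mult_left_mono[OF h(1) assms(2)] mult_left_mono[OF h(2) assms(2)]
    by (intro real_levelI) (auto simp: algebra_simps simp flip: sum_distrib_left)
  then show ?thesis
    by (simp add: z edge_comb_scale)
qed

lemma real_level_0:
  assumes "k \<ge> 1"
  shows "real_level k a 0 \<subseteq> {0}"
proof
  fix z assume "z \<in> real_level k a 0"
  then obtain w :: "nat \<Rightarrow> real" and h :: real where z: "z = (edge_comb k w, h)" and w: "\<forall>i\<in>{1..2*k}. 0 \<le> w i"
    "sum w {1..2*k} = 0" and h: "a * w 1 \<le> h" "h \<le> a * w 1 + 0"
    by (rule real_levelE)
  have w0: "w i = 0" if "i \<in> {1..2*k}" for i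
    using w that sum_nonneg_eq_0_iff[of "{1..2*k}" w] by auto
  then have "edge_comb k w = 0"
    by (simp add: edge_comb_def)
  moreover have "h = 0"
    using h w0[of 1] assms by simp
  ultimately show "z \<in> {0}"
    by (simp add: z zero_prod_def)
qed

lemma dilate_cyc_polytope:
  assumes "k \<ge> 1"
  shows "dilate m (cyc_polytope k a) = real_level k a m"
proof
  show "dilate m (cyc_polytope k a) \<subseteq> real_level k a m"
    using real_level_scale[of _ k a 1 "real m"]
    by (auto simp: dilate_def cyc_polytope_eq_real_level[OF assms])
next
  show "real_level k a m \<subseteq> dilate m (cyc_polytope k a)"
  proof
    fix z assume z: "z \<in> real_level k a m"
    show "z \<in> dilate m (cyc_polytope k a)"
    proof (cases "m = 0")
      case True
      have "(edge_vec (cyc_edge k 1), real a) \<in> cyc_polytope k a"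
        using edge_in_real_level[OF assms, of 1 a a] assms
        by (simp add: cyc_polytope_eq_real_level[OF assms] base_height_def)
      then show ?thesis
        using z real_level_0[OF assms] True by (force simp: dilate_def)
    next
      case False
      then have "(1 / m) *\<^sub>R z \<in> cyc_polytope k a"
        using real_level_scale[OF z, of "1 / m"] by (simp add: cyc_polytope_eq_real_level[OF assms])
      then show ?thesis
        unfolding dilate_def by (rule rev_image_eqI) (use False in simp)
    qed
  qed
qed

section \<open>Rounding a weighting along the alternating direction\<close>

lemma nonneg_Ints_imp_nat:
  fixes x :: real
  assumes "x \<in> \<int>" and "0 \<le> x"
  shows "real (nat \<lfloor>x\<rfloor>) = x"
  using assms by (auto simp: Ints_def)

lemma Ints_ge_iff_gt:
  fixes x y :: real
  assumes "x \<in> \<int>" and "y \<in> \<int>"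
  shows "x + 1 \<le> y \<longleftrightarrow> x < y"
proof -
  obtain p q where "x = of_int p" "y = of_int q"
    using assms by (auto simp: Ints_def)
  then show ?thesis
    using int_less_real_le[of p q] by simp
qed

lemma int_levelI_shift:
  assumes "k \<ge> 1" and "\<And>i. i \<in> {1..2*k} \<Longrightarrow> w i - alternate d i \<in> \<int>"
    and "\<And>i. i \<in> {1..2*k} \<Longrightarrow> 0 \<le> w i - alternate d i" and "sum w {1..2*k} = real m"
    and "h \<in> \<int>" and "a * (w 1 - d) \<le> h" and "h \<le> a * (w 1 - d) + m"
  shows "(edge_comb k w, h) \<in> int_level k a m"
proof -
  define u where "u i = nat \<lfloor>w i - alternate d i\<rfloor>" for i
  have u: "real (u i) = w i - alternate d i" if "i \<in> {1..2*k}" for i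
    unfolding u_def using that assms(2,3) by (intro nonneg_Ints_imp_nat) auto
  have u1: "real (u 1) = w 1 - d"
    using u[of 1] assms(1) by (simp add: alternate_def)
  have "edge_comb k w = edge_comb k (\<lambda>i. (w i - alternate d i) + alternate d i)"
    by simp
  also have "\<dots> = edge_comb k (\<lambda>i. w i - alternate d i)"
    unfolding edge_comb_add by (simp add: edge_comb_alternate[OF assms(1)])
  also have "\<dots> = edge_comb k (\<lambda>i. real (u i))"
    by (rule edge_comb_cong) (simp add: u)
  finally have x: "edge_comb k w = edge_comb k (\<lambda>i. real (u i))" .
  have "real (sum u {1..2*k}) = (\<Sum>i=1..2*k. w i - alternate d i)"
    by (simp add: u)
  also have "\<dots> = real m"
    using assms(4) by (simp add: sum_subtractf sum_alternate)
  finally have sum_u: "sum u {1..2*k} = m"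
    by (simp only: of_nat_eq_iff)
  have "0 \<le> real a * real (u 1)"
    by simp
  then have h: "real (nat \<lfloor>h\<rfloor>) = h"
    using assms(5,6) unfolding u1 by (intro nonneg_Ints_imp_nat) auto
  have "real (a * u 1) \<le> real (nat \<lfloor>h\<rfloor>)" "real (nat \<lfloor>h\<rfloor>) \<le> real (a * u 1 + m)"
    using assms(6,7) unfolding h of_nat_add of_nat_mult u1 by auto
  then have "a * u 1 \<le> nat \<lfloor>h\<rfloor>" "nat \<lfloor>h\<rfloor> \<le> a * u 1 + m"
    by (simp_all only: of_nat_le_iff)
  then show ?thesis
    using sum_u h unfolding int_level_def x
    by (intro CollectI exI[of _ u] exI[of _ "nat \<lfloor>h\<rfloor>"]) simp
qed

text \<open>
  Adjacent weights have integral sum, so from edge to edge the fractional part only changes sign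
  modulo \<open>1\<close>.
\<close>

lemma weight_fractions:
  assumes "k \<ge> 1" and "(edge_comb k w, h) \<in> cyc_lattice k" and "i \<in> {1..2*k}"
  shows "w i - alternate (frac (w 1)) i \<in> \<int>"
proof -
  have adj: "w j + w (Suc j) \<in> \<int>" if "j \<in> {1..<2*k}" for j
    using assms(2) edge_comb_mem_lattice[OF assms(1), of h w] that by (auto simp: cyc_lattice_def)
  have "1 \<le> i" "i \<le> 2*k"
    using assms(3) by auto
  then show ?thesis
  proof (induction i rule: dec_induct)
    case base
    then show ?case by (simp add: alternate_def frac_def)
  next
    case (step i)
    have "w (Suc i) - alternate (frac (w 1)) (Suc i) =
        (w i + w (Suc i)) - (w i - alternate (frac (w 1)) i)"
      by (simp add: alternate_def)
    also have "\<dots> \<in> \<int>"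
      by (rule Ints_diff) (use step adj[of i] in auto)
    finally show ?case .
  qed
qed

text \<open>
  With \<open>f\<close> the fractional part of \<open>w\<^sub>1\<close>, the two candidates are the shifts of \<open>w\<close> by \<open>f\<close> and by
  \<open>f - 1\<close>. Both are nonnegative because a number above \<open>-1\<close> that is integral is nonnegative. If the
  height is too large for the first one, then \<open>f > 0\<close>, the first shift is at least \<open>1\<close> on the \<open>k\<close> even
  edges, so \<open>m \<ge> k\<close>; the hypothesis then gives \<open>a \<le> m + 1\<close>, and the height intervals of the two shifts
  leave no integer between them.
\<close>

lemma lattice_point_in_int_level:
  assumes "k \<ge> 1" and z: "z \<in> real_level k a m" "z \<in> cyc_lattice k" and m: "m < k \<or> a \<le> m + 1"
  shows "z \<in> int_level k a m"
proof -
  obtain w :: "nat \<Rightarrow> real" and h :: real where zeq: "z = (edge_comb k w, h)" and w: "\<forall>i\<in>{1..2*k}. 0 \<le> w i"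
    "sum w {1..2*k} = m" and h: "a * w 1 \<le> h" "h \<le> a * w 1 + m"
    using z(1) by (rule real_levelE)
  define f where "f = frac (w 1)"
  define v where "v i = w i - alternate f i" for i
  have f: "0 \<le> f" "f < 1"
    by (simp_all add: f_def frac_lt_1)
  have hZ: "h \<in> \<int>"
    using z(2) by (simp add: zeq cyc_lattice_def)
  have vZ: "v i \<in> \<int>" if "i \<in> {1..2*k}" for i
    using weight_fractions[OF assms(1) z(2)[unfolded zeq] that] by (simp add: v_def f_def)
  have v0: "0 \<le> v i" if "i \<in> {1..2*k}" for i
  proof -
    have "-1 < v i"
      using bspec[OF w(1) that] f by (simp add: v_def alternate_def)
    then show ?thesis
      using Ints_ge_iff_gt[OF _ vZ[OF that], of "-1"] by simp
  qed
  have v1: "v 1 = w 1 - f"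
    by (simp add: v_def alternate_def)
  have v1Z: "v 1 \<in> \<int>"
    using vZ assms(1) by simp
  have low: "real a * v 1 \<le> h"
    using h(1) f(1) mult_left_mono[of "v 1" "w 1" "real a"] unfolding v1 by simp
  show ?thesis
  proof (cases "h \<le> a * v 1 + m")
    case True
    then show ?thesis
      unfolding zeq using assms(1) vZ v0 w(2) hZ low
      by (intro int_levelI_shift[where d = f]) (auto simp: v_def alternate_def)
  next
    case False
    have "f \<noteq> 0"
      using False h(2) unfolding v1 by auto
    with f have "0 < f" by simp
    have even1: "1 \<le> v i" if "i \<in> {1..2*k}" "even i" for i
    proof -
      have "0 < v i"
        using w(1) \<open>0 < f\<close> that by (simp add: v_def alternate_def add_nonneg_pos)
      then show ?thesis
        using Ints_ge_iff_gt[OF _ vZ[OF that(1)], of 0] by simp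
    qed
    \<comment> \<open>\<open>1 / 2 - alternate (1 / 2) i\<close> is the indicator of the even edges.\<close>
    have "real k = (\<Sum>i=1..2*k. 1 / 2 - alternate (1 / 2) i)"
      by (simp add: sum_subtractf sum_alternate)
    also have "\<dots> \<le> (\<Sum>i=1..2*k. v i)"
      by (intro sum_mono) (use v0 even1 in \<open>auto simp: alternate_def\<close>)
    also have "\<dots> = m"
      using w(2) by (simp add: v_def sum_subtractf sum_alternate)
    finally have "a \<le> m + 1"
      using m by simp
    then have am: "real a \<le> real m + 1"
      by simp
    have "real a * v 1 + m \<in> \<int>"
      using v1Z by auto
    then have "real a * v 1 + m + 1 \<le> h"
      using Ints_ge_iff_gt[OF _ hZ] False by auto
    with am have up: "real a * (v 1 + 1) \<le> h"
      by (simp add: algebra_simps)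
    have "real a * w 1 \<le> real a * (v 1 + 1)"
      using f v1 by (intro mult_left_mono) auto
    then have up2: "h \<le> real a * (v 1 + 1) + m"
      using h(2) by simp
    have shift: "w i - alternate (f - 1) i = v i + (if odd i then 1 else -1)" for i
      by (simp add: v_def alternate_def)
    show ?thesis
      unfolding zeq
    proof (rule int_levelI_shift[where d = "f - 1"])
      show "w i - alternate (f - 1) i \<in> \<int>" if "i \<in> {1..2*k}" for i
        unfolding shift using vZ[OF that] by auto
      show "0 \<le> w i - alternate (f - 1) i" if "i \<in> {1..2*k}" for i
        unfolding shift using v0[OF that] even1[OF that] by auto
      have "w 1 - (f - 1) = v 1 + 1"
        by (simp only: v1)
      then show "real a * (w 1 - (f - 1)) \<le> h" "h \<le> real a * (w 1 - (f - 1)) + m"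
        using up up2 by (simp_all only:)
    qed (use assms(1) w(2) hZ in auto)
  qed
qed

section \<open>Sums of lattice points\<close>

lemma add_vertex:
  assumes "i \<in> {1..2*k}"
  shows "(edge_comb k (\<lambda>j. real (u j)), real h) + (edge_vec (cyc_edge k i), real h') =
    (edge_comb k (\<lambda>j. real (u j + (if j = i then 1 else 0))), real (h + h'))"
 proof -
  have "edge_comb k (\<lambda>j. real (u j + (if j = i then 1 else 0))) =
      edge_comb k (\<lambda>j. real (u j) + (if j = i then 1 else 0))"
    by (rule edge_comb_cong) simp
  then show ?thesis
    by (simp only: edge_comb_add edge_comb_indicator[OF assms] add_Pair of_nat_add)
qed

text \<open>
  To split off a summand, take any edge \<open>i\<close> of positive weight. The height of the summand over it may be
  chosen as the lower of the two possible ones exactly if the total height is minimal, and as the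
  upper one otherwise; this keeps the remaining height in the range prescribed by the remaining
  weights.
\<close>

lemma nfold_sums_vertices:
  assumes "k \<ge> 1"
  shows "nfold_sums (cyc_vertices k a) m = int_level k a m"
proof (induction m)
  case 0
  have "z = 0" if z: "z \<in> int_level k a 0" for z
  proof -
    obtain u and h :: nat where "z = (edge_comb k (\<lambda>i. real (u i)), real h)"
      and "sum u {1..2*k} = 0" "a * u 1 \<le> h" "h \<le> a * u 1 + 0"
      using z unfolding int_level_def by blast
    then show ?thesis
      using assms by (auto simp: edge_comb_def zero_prod_def)
  qed
  moreover have "0 \<in> int_level k a 0"
    unfolding int_level_def
    by (rule CollectI, intro exI[of _ "\<lambda>_. 0"] exI[of _ 0]) (simp add: edge_comb_def zero_prod_def)
  ultimately show ?case by auto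
next
  case (Suc m)
  show ?case
  proof (intro equalityI subsetI)
    fix z assume "z \<in> nfold_sums (cyc_vertices k a) (Suc m)"
    then obtain u i d and h :: nat where u: "sum u {1..2*k} = m" "a * u 1 \<le> h" "h \<le> a * u 1 + m"
      and i: "i \<in> {1..2*k}" and d: "d \<in> {0,1::nat}"
      and z: "z = (edge_comb k (\<lambda>j. real (u j)), real h) +
        (edge_vec (cyc_edge k i), real (base_height a i + d))"
      unfolding nfold_sums_Suc Suc unfolding cyc_vertices_def int_level_def by blast
    define u' where "u' j = u j + (if j = i then 1 else 0)" for j
    have "sum u' {1..2*k} = Suc m"
      using i u(1) by (simp add: u'_def sum.distrib)
    moreover have "a * u' 1 = a * u 1 + base_height a i"
      by (simp add: u'_def base_height_def)
    ultimately show "z \<in> int_level k a (Suc m)"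
      using u d unfolding z add_vertex[OF i] u'_def[symmetric] int_level_def
      by (intro CollectI exI[of _ u'] exI[of _ "h + (base_height a i + d)"]) auto
  next
    fix z assume "z \<in> int_level k a (Suc m)"
    then obtain u' and h :: nat where z: "z = (edge_comb k (\<lambda>i. real (u' i)), real h)"
      and u': "sum u' {1..2*k} = Suc m" "a * u' 1 \<le> h" "h \<le> a * u' 1 + Suc m"
      unfolding int_level_def by blast
    obtain i where i: "i \<in> {1..2*k}" "u' i \<noteq> 0"
      using u'(1) by (metis sum.neutral nat.distinct(1))
    define u where "u j = u' j - (if j = i then 1 else 0)" for j
    have u'_eq: "u' j = u j + (if j = i then 1 else 0)" for j
      using i(2) by (simp add: u_def)
    define d :: nat where "d = (if h = a * u' 1 then 0 else 1)"
    define h' where "h' = h - (base_height a i + d)"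
    have "sum u {1..2*k} = m"
      using i u'(1) by (simp add: u'_eq sum.distrib)
    moreover have a: "a * u' 1 = a * u 1 + base_height a i"
      by (simp add: u'_eq base_height_def)
    moreover have d: "a * u' 1 + d \<le> h" "h \<le> a * u' 1 + d + m"
      using u' by (auto simp: d_def)
    moreover have h: "h = h' + (base_height a i + d)"
      using a d by (simp add: h'_def)
    ultimately have "(edge_comb k (\<lambda>j. real (u j)), real h') \<in> int_level k a m"
      unfolding int_level_def by (intro CollectI exI[of _ u] exI[of _ h']) auto
    moreover have "(edge_vec (cyc_edge k i), real (base_height a i + d)) \<in> cyc_vertices k a"
      unfolding cyc_vertices_def using i(1) by (auto simp: d_def)
    moreover have "z = (edge_comb k (\<lambda>j. real (u j)), real h') +
        (edge_vec (cyc_edge k i), real (base_height a i + d))"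
      unfolding z add_vertex[OF i(1)] h u'_eq ..
    ultimately show "z \<in> nfold_sums (cyc_vertices k a) (Suc m)"
      unfolding nfold_sums_Suc Suc by blast
  qed
qed

lemma int_level_subset:
  assumes "k \<ge> 1"
  shows "int_level k a m \<subseteq> real_level k a m \<inter> cyc_lattice k"
proof
  fix z assume "z \<in> int_level k a m"
  then obtain u and h :: nat where z: "z = (edge_comb k (\<lambda>i. real (u i)), real h)"
    and u: "sum u {1..2*k} = m" "a * u 1 \<le> h" "h \<le> a * u 1 + m"
    unfolding int_level_def by blast
  have "z \<in> real_level k a m"
    unfolding z
  proof (rule real_levelI)
    show "real a * real (u 1) \<le> real h" "real h \<le> real a * real (u 1) + real m"
      using u(2,3) by (simp_all flip: of_nat_mult of_nat_add)
  qed (use u(1) in auto)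
  moreover have "z \<in> cyc_lattice k"
    unfolding z by (subst edge_comb_mem_lattice[OF assms]) auto
  ultimately show "z \<in> real_level k a m \<inter> cyc_lattice k"
    by blast
qed

lemma cyc_vertices_eq_int_level:
  "k \<ge> 1 \<Longrightarrow> cyc_vertices k a = int_level k a 1"
  using nfold_sums_vertices[of k a 1] by simp

lemma finite_int_level:
  assumes "k \<ge> 1"
  shows "finite (int_level k a m)"
proof -
  have "finite (nfold_sums (cyc_vertices k a) m)"
  proof (induction m)
    case (Suc m)
    have "finite (cyc_vertices k a)"
      by (simp add: cyc_vertices_def)
    then show ?case
      unfolding nfold_sums_Suc using Suc by (intro finite_image_set2) auto
  qed simp
  then show ?thesis
    by (simp add: nfold_sums_vertices[OF assms])
qed

text \<open>
  The heights are bounded. For the vertex sums the rounding argument applies with \<open>a = 0\<close>, where its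
  condition \<open>a \<le> m + 1\<close> always holds: every integral vector of vertex sums comes from one of the
  finitely many integral weightings of total weight \<open>m\<close>.
\<close>

lemma finite_dilate_cyc_polytope:
  assumes "k \<ge> 1"
  shows "finite (dilate m (cyc_polytope k a) \<inter> cyc_lattice k)"
proof (rule finite_subset)
  show "finite (fst ` int_level k 0 m \<times> real ` {..a * m + m})"
    using finite_int_level[OF assms] by simp
  show "dilate m (cyc_polytope k a) \<inter> cyc_lattice k \<subseteq>
      fst ` int_level k 0 m \<times> real ` {..a * m + m}"
  proof
    fix z assume "z \<in> dilate m (cyc_polytope k a) \<inter> cyc_lattice k"
    then have z: "z \<in> real_level k a m" "z \<in> cyc_lattice k"
      by (simp_all add: dilate_cyc_polytope[OF assms])
    obtain w :: "nat \<Rightarrow> real" and h :: real where zeq: "z = (edge_comb k w, h)" and w: "\<forall>i\<in>{1..2*k}. 0 \<le> w i"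
      "sum w {1..2*k} = m" and h: "a * w 1 \<le> h" "h \<le> a * w 1 + m"
      using z(1) by (rule real_levelE)
    have "(edge_comb k w, 0) \<in> real_level k 0 m"
      using w by (intro real_levelI) auto
    moreover have "(edge_comb k w, 0) \<in> cyc_lattice k"
      using z(2) by (simp add: zeq cyc_lattice_def)
    ultimately have "(edge_comb k w, 0) \<in> int_level k 0 m"
      by (intro lattice_point_in_int_level[OF assms]) auto
    then have "edge_comb k w \<in> fst ` int_level k 0 m"
      by force
    moreover have "h \<in> real ` {..a * m + m}"
    proof -
      have w1: "0 \<le> w 1"
        using w(1) assms by simp
      have "w 1 \<le> m"
        using w assms member_le_sum[of 1 "{1..2*k}" w] by simp
      then have "real a * w 1 \<le> real a * m"
        by (rule mult_left_mono) simp
      moreover have "0 \<le> real a * w 1"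
        using w1 by simp
      ultimately have "0 \<le> h" "h \<le> real (a * m + m)"
        using h by auto
      moreover have "h \<in> \<int>"
        using z(2) by (simp add: zeq cyc_lattice_def)
      ultimately have "h = real (nat \<lfloor>h\<rfloor>)" "nat \<lfloor>h\<rfloor> \<le> a * m + m"
        using nonneg_Ints_imp_nat[of h] by (simp, linarith)
      then show ?thesis by blast
    qed
    ultimately show "z \<in> fst ` int_level k 0 m \<times> real ` {..a * m + m}"
      by (simp add: zeq)
  qed
qed

text \<open>
  An integral weighting with all vertex sums equal to \<open>1\<close> has first weight \<open>0\<close> or \<open>1\<close>, which forces a
  height of at most \<open>k\<close> or of at least \<open>k + 2\<close>. The constant weighting \<open>1 / 2\<close> allows the
  height \<open>k + 1\<close>, since \<open>(k + 2) / 2 \<le> k + 1 \<le> (k + 2) / 2 + k\<close>.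
\<close>

lemma gap_point:
  assumes "k \<ge> 1"
  shows "(edge_comb k (\<lambda>_. 1 / 2), real (k + 1)) \<in>
    real_level k (k + 2) k \<inter> cyc_lattice k - int_level k (k + 2) k"
proof -
  have "(edge_comb k (\<lambda>_. 1 / 2), real (k + 1)) \<notin> int_level k (k + 2) k"
  proof
    assume "(edge_comb k (\<lambda>_. 1 / 2), real (k + 1)) \<in> int_level k (k + 2) k"
    then obtain u and h :: nat where eq: "edge_comb k (\<lambda>_. 1 / 2) = edge_comb k (\<lambda>i. real (u i))"
      "real (k + 1) = real h" and h: "(k + 2) * u 1 \<le> h" "h \<le> (k + 2) * u 1 + k"
      unfolding int_level_def by blast
    have "h = k + 1"
      using eq(2) by (simp only: of_nat_eq_iff)
    moreover have "1 = real (u 2) + real (u 1)"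
      using arg_cong[OF eq(1), of "\<lambda>x. Poly_Mapping.lookup x 2"] assms
      by (simp add: lookup_edge_comb)
    then have "u 1 = 0 \<or> u 1 = 1"
      by linarith
    ultimately show False
      using h by auto
  qed
  moreover have "(edge_comb k (\<lambda>_. 1 / 2), real (k + 1)) \<in> real_level k (k + 2) k"
    by (rule real_levelI) auto
  moreover have "(edge_comb k (\<lambda>_. 1 / 2), real (k + 1)) \<in> cyc_lattice k"
    by (subst edge_comb_mem_lattice[OF assms]) auto
  ultimately show ?thesis
    by blast
qed

section \<open>The gap vector\<close>

text \<open>
  The rounding argument at level \<open>m = 1 < k\<close>: the lattice points of the polytope are just its
  generators.
\<close>

lemma lattice_points_cyc_polytope:
  assumes "k \<ge> 2"
  shows "cyc_polytope k a \<inter> cyc_lattice k = cyc_vertices k a"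
proof -
  have "real_level k a 1 \<inter> cyc_lattice k \<subseteq> int_level k a 1"
    using lattice_point_in_int_level[of k _ a 1] assms by auto
  then show ?thesis
    using int_level_subset[of k a 1] assms
    by (auto simp: cyc_polytope_eq_real_level cyc_vertices_eq_int_level)
qed

lemma lattice_polytope_cyc_polytope:
  assumes "k \<ge> 1"
  shows "lattice_polytope (cyc_lattice k) (cyc_polytope k a)"
  unfolding lattice_polytope_def cyc_polytope_eq_hull[OF assms]
  using finite_int_level[OF assms, of a 1] int_level_subset[OF assms, of a 1]
  by (intro exI[of _ "cyc_vertices k a"]) (auto simp: cyc_vertices_eq_int_level[OF assms])

lemma nfold_sums_cyc_polytope:
  assumes "k \<ge> 2"
  shows "nfold_sums (cyc_polytope k a \<inter> cyc_lattice k) m = int_level k a m"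
  using assms by (simp add: lattice_points_cyc_polytope nfold_sums_vertices)

lemma int_level_subset_dilate:
  assumes "k \<ge> 1"
  shows "int_level k a m \<subseteq> dilate m (cyc_polytope k a) \<inter> cyc_lattice k"
  using int_level_subset[OF assms] by (simp add: dilate_cyc_polytope[OF assms])

lemma int_level_eq_dilate_iff:
  assumes "k \<ge> 1"
  shows "int_level k (k + 2) m = dilate m (cyc_polytope k (k + 2)) \<inter> cyc_lattice k \<longleftrightarrow> m \<noteq> k"
proof (cases "m = k")
  case True
  then show ?thesis
    using gap_point[OF assms] by (auto simp: dilate_cyc_polytope[OF assms])
next
  case False
  then have "m < k \<or> k + 2 \<le> m + 1"
    by auto
  then show ?thesis
    using False int_level_subset[OF assms, of "k + 2" m]
      lattice_point_in_int_level[OF assms, of _ "k + 2" m]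
    by (auto simp: dilate_cyc_polytope[OF assms])
qed

lemma int_level_nonempty:
  assumes "k \<ge> 1"
  shows "int_level k a m \<noteq> {}"
proof -
  have "(edge_comb k (\<lambda>i. real (if i = 2 then m else 0)), real 0) \<in> int_level k a m"
    unfolding int_level_def using assms
    by (intro CollectI exI[of _ "\<lambda>i. if i = 2 then m else 0"] exI[of _ 0]) auto
  then show ?thesis by blast
qed

theorem mainTheorem6:
  fixes k1 k2 :: nat
  assumes "k1 \<ge> 2" and "k2 \<ge> 2" and "k1 \<noteq> k2"
  shows "very_ample (cyc_lattice k1 \<times> cyc_lattice k2)
           (cyc_polytope k1 (k1 + 2) \<times> cyc_polytope k2 (k2 + 2))
       \<and> {j. j \<ge> 1 \<and>
             gap_vector (cyc_lattice k1 \<times> cyc_lattice k2)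
               (cyc_polytope k1 (k1 + 2) \<times> cyc_polytope k2 (k2 + 2)) j \<noteq> 0} = {k1, k2}"
proof -
  let ?M = "cyc_lattice k1 \<times> cyc_lattice k2"
  let ?P = "cyc_polytope k1 (k1 + 2) \<times> cyc_polytope k2 (k2 + 2)"
  let ?D = "\<lambda>k m. dilate m (cyc_polytope k (k + 2)) \<inter> cyc_lattice k"
  let ?S = "\<lambda>k m. int_level k (k + 2) m"
  have k: "k1 \<ge> 1" "k2 \<ge> 1"
    using assms by auto
  have S: "nfold_sums (?P \<inter> ?M) m = ?S k1 m \<times> ?S k2 m" for m
    unfolding Times_Int_Times nfold_sums_Times
    by (simp only: nfold_sums_cyc_polytope[OF assms(1)] nfold_sums_cyc_polytope[OF assms(2)])
  have D: "dilate m ?P \<inter> ?M = ?D k1 m \<times> ?D k2 m" for m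
    unfolding dilate_Times Times_Int_Times ..
  have sub: "?S k1 m \<subseteq> ?D k1 m" "?S k2 m \<subseteq> ?D k2 m" for m
    by (rule int_level_subset_dilate[OF k(1)], rule int_level_subset_dilate[OF k(2)])
  have eq_iff: "nfold_sums (?P \<inter> ?M) m = dilate m ?P \<inter> ?M \<longleftrightarrow> m \<noteq> k1 \<and> m \<noteq> k2" for m
    unfolding S D Times_eq_iff_of_subset[OF sub int_level_nonempty[OF k(1)] int_level_nonempty[OF k(2)]]
    by (simp only: int_level_eq_dilate_iff[OF k(1)] int_level_eq_dilate_iff[OF k(2)])
  have "gap_vector ?M ?P j \<noteq> 0 \<longleftrightarrow> j = k1 \<or> j = k2" if "j \<ge> 1" for j
  proof -
    have "finite (dilate j ?P \<inter> ?M)"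
      unfolding D by (intro finite_cartesian_product finite_dilate_cyc_polytope k)
    moreover have "nfold_sums (?P \<inter> ?M) j \<subseteq> dilate j ?P \<inter> ?M"
      unfolding S D using sub by (rule Sigma_mono)
    ultimately show ?thesis
      using gap_vector_nonzero_iff[OF that, of ?P ?M] eq_iff[of j] by blast
  qed
  then have "{j. j \<ge> 1 \<and> gap_vector ?M ?P j \<noteq> 0} = {k1, k2}"
    using k by auto
  moreover have "very_ample ?M ?P"
    unfolding very_ample_iff_nfold_sums
  proof
    show "lattice_polytope ?M ?P"
      by (intro lattice_polytope_Times lattice_polytope_cyc_polytope k)
    have "dilate m ?P \<inter> ?M \<subseteq> nfold_sums (?P \<inter> ?M) m" if "m \<ge> k1 + k2 + 1" for m
      using eq_iff[of m] that by simp
    then show "\<exists>m0. \<forall>m\<ge>m0. dilate m ?P \<inter> ?M \<subseteq> nfold_sums (?P \<inter> ?M) m"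
      by blast
  qed
  ultimately show ?thesis by blast
qed

end
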